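(* Let $k$ be a nonnegative integer, let $H$ be a self $k$-resolved graph of order $n_2$, and let $G$ be a nontrivial connected graph of order $n_1$ having $t_1$ true twin equivalence classes and diameter $D(G)<k$. If $\dim(G)=n_1-t_1$, then $\dim(G\boxtimes H)=n_2(n_1-t_1)$.
   Context: All graphs are simple and connected; $d_G$ is the shortest-path distance. A set $S\subseteq V(G)$ is a metric generator for $G$ if for every two distinct vertices $x,y$ there is $s\in S$ with $d_G(s,x)\ne d_G(s,y)$; $\dim(G)$ is the minimum cardinality of a metric generator. The strong product $G\boxtimes H$ has vertex set $V(G)\times V(H)$, with $(a,b)$ and $(c,d)$ adjacent iff ($a=c$ and $bd\in E(H)$) or ($b=d$ and $ac\in E(G)$) or ($ac\in E(G)$ and $bd\in E(H)$). The interval $I[x,y]$ is the set of vertices on some shortest $x$–$y$ path. A connected graph $H$ is self $k$-resolved if for every two distinct vertices $x,y$ there is $w$ with either $d_H(y,w)\ge k$ and $x\in I[y,w]$, or $d_H(x,w)\ge k$ and $y\in I[x,w]$. The true twin equivalence classes of $G$ are the classes of the relation $x\sim y\iff N_G[x]=N_G[y]$, where $N_G[v]$ is the closed neighborhood. Nontrivial means at least two vertices. *)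

theory Defs
  imports "Graph_Theory.Graph_Theory"
begin

text \<open>
  A finite simple graph is a \<^locale>\<open>pair_graph\<close>: a finite vertex set with an irreflexive symmetric
  arc relation, so every undirected edge \<open>uv\<close> is present as the two arcs \<open>(u, v)\<close> and \<open>(v, u)\<close>.
  Connectedness is \<^const>\<open>Digraph_Component.connected\<close>, which includes nonemptiness.
  The lists \<open>p\<close> below are lists of arcs, so \<open>length p\<close> is the number of edges.
\<close>

definition gdist :: "'a pair_pre_digraph \<Rightarrow> 'a \<Rightarrow> 'a \<Rightarrow> nat" where
  "gdist G u v = (LEAST n. \<exists>p. pre_digraph.apath (with_proj G) u p v \<and> length p = n)"

definition diameter :: "'a pair_pre_digraph \<Rightarrow> nat" where
  "diameter G = Max {gdist G u v | u v. u \<in> pverts G \<and> v \<in> pverts G}"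

definition geodesic_interval :: "'a pair_pre_digraph \<Rightarrow> 'a \<Rightarrow> 'a \<Rightarrow> 'a set" where
  "geodesic_interval G x y =
     {v. \<exists>p. pre_digraph.apath (with_proj G) x p y \<and> length p = gdist G x y \<and>
             v \<in> set (pre_digraph.awalk_verts (with_proj G) x p)}"

definition metric_generator :: "'a pair_pre_digraph \<Rightarrow> 'a set \<Rightarrow> bool" where
  "metric_generator G S \<longleftrightarrow>
     S \<subseteq> pverts G \<and>
     (\<forall>x \<in> pverts G. \<forall>y \<in> pverts G. x \<noteq> y \<longrightarrow> (\<exists>s \<in> S. gdist G s x \<noteq> gdist G s y))"

definition metric_dim :: "'a pair_pre_digraph \<Rightarrow> nat" where
  "metric_dim G = (LEAST n. \<exists>S. finite S \<and> metric_generator G S \<and> card S = n)"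

definition strong_product ::
  "'a pair_pre_digraph \<Rightarrow> 'b pair_pre_digraph \<Rightarrow> ('a \<times> 'b) pair_pre_digraph" where
  "strong_product G H =
     \<lparr> pverts = pverts G \<times> pverts H,
       parcs = {((a, b), (c, d)) | a b c d.
                  (a = c \<and> a \<in> pverts G \<and> (b, d) \<in> parcs H) \<or>
                  (b = d \<and> b \<in> pverts H \<and> (a, c) \<in> parcs G) \<or>
                  ((a, c) \<in> parcs G \<and> (b, d) \<in> parcs H)} \<rparr>"

definition self_resolved :: "nat \<Rightarrow> 'a pair_pre_digraph \<Rightarrow> bool" where
  "self_resolved k H \<longleftrightarrow>
     Digraph_Component.connected (with_proj H) \<and>
     (\<forall>x \<in> pverts H. \<forall>y \<in> pverts H. x \<noteq> y \<longrightarrow>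
        (\<exists>w \<in> pverts H.
           (gdist H y w \<ge> k \<and> x \<in> geodesic_interval H y w) \<or>
           (gdist H x w \<ge> k \<and> y \<in> geodesic_interval H x w)))"

definition closed_nbhd :: "'a pair_pre_digraph \<Rightarrow> 'a \<Rightarrow> 'a set" where
  "closed_nbhd G v = insert v {u. (v, u) \<in> parcs G}"

definition true_twin_rel :: "'a pair_pre_digraph \<Rightarrow> 'a rel" where
  "true_twin_rel G =
     {(x, y). x \<in> pverts G \<and> y \<in> pverts G \<and> closed_nbhd G x = closed_nbhd G y}"

definition true_twin_classes :: "'a pair_pre_digraph \<Rightarrow> 'a set set" where
  "true_twin_classes G = pverts G // true_twin_rel G"

end

theory Submission
  imports Defs
begin

text \<open>
  Closed adjacency (adjacent or equal) in \<open>G \<boxtimes> H\<close> is the product of the closed adjacencies of the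
  factors, so balls are products of balls and distances are maxima of distances. If \<open>S\<close> is a metric
  basis of \<open>G\<close>, then \<open>S \<times> V(H)\<close> resolves \<open>G \<boxtimes> H\<close>: vertices in the same \<open>G\<close>-layer are resolved by
  that layer's copy of \<open>S\<close>; if \<open>b \<noteq> d\<close>, a \<open>w\<close> with \<open>d\<^sub>H(d, w) \<ge> k > D(G)\<close> and \<open>b\<close> on a shortest path
  from \<open>d\<close> to \<open>w\<close> gives \<open>(s, w)\<close> resolving \<open>(a, b)\<close> and \<open>(c, d)\<close>, the \<open>G\<close>-coordinates being too
  close to matter. Conversely, true twins \<open>a\<close>, \<open>a'\<close> of \<open>G\<close> give true twins \<open>(a, b)\<close>, \<open>(a', b)\<close>, which
  only themselves resolve; hence the complement of any metric generator injects into the pairs of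
  a twin class and a vertex of \<open>H\<close>.
\<close>

section \<open>Distances as powers of closed adjacency\<close>

definition closed_adj :: "'a pair_pre_digraph \<Rightarrow> 'a rel" where
  "closed_adj G = parcs G \<union> Id_on (pverts G)"

text \<open>The loops of \<open>closed_adj G\<close> pad a shorter walk to exactly \<open>n\<close>
  steps, so the \<open>n\<close>-th power is the ball relation of radius \<open>n\<close>, not the
  sphere relation.\<close>

lemma (in pair_wf_digraph) awalk_imp_closed_adj_power:
  assumes "awalk u p v" and "length p \<le> n"
  shows "(u, v) \<in> closed_adj G ^^ n"
  using assms
proof (induction n arbitrary: u p)
  case 0
  then show ?case by (simp add: awalk_Nil_iff)
next
  case (Suc n)
  show ?case
  proof (cases p)
    case Nil
    then have "u = v" "u \<in> pverts G" using Suc.prems by (auto simp: awalk_Nil_iff)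
    then have "(u, v) \<in> closed_adj G ^^ n" and "(u, u) \<in> closed_adj G"
      using Suc.IH[of u "[]"] by (auto simp: awalk_Nil_iff closed_adj_def)
    then show ?thesis by (rule relpow_Suc_I2[rotated])
  next
    case (Cons e es)
    then have "awalk (snd e) es v" "(u, snd e) \<in> closed_adj G"
      using Suc.prems by (auto simp: awalk_Cons_iff closed_adj_def)
    moreover have "length es \<le> n" using Cons Suc.prems by simp
    ultimately show ?thesis using Suc.IH by (blast intro: relpow_Suc_I2)
  qed
qed

text \<open>Dropping the loop steps leaves a walk. The assumption on \<open>u\<close> matters at
  \<open>n = 0\<close>, where the power is the identity on the whole type.\<close>

lemma (in pair_wf_digraph) closed_adj_power_imp_awalk:
  assumes "u \<in> pverts G" and "(u, v) \<in> closed_adj G ^^ n"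
  shows "\<exists>p. awalk u p v \<and> length p \<le> n"
  using assms
proof (induction n arbitrary: u)
  case 0
  then show ?case by (auto simp: awalk_Nil_iff)
next
  case (Suc n)
  obtain w where w: "(u, w) \<in> closed_adj G" "(w, v) \<in> closed_adj G ^^ n"
    using Suc.prems(2) by (rule relpow_Suc_E2)
  have "w \<in> pverts G" using w(1) in_arcsD2 by (auto simp: closed_adj_def)
  then obtain p where p: "awalk w p v" "length p \<le> n" using Suc.IH w(2) by blast
  show ?case
  proof (cases "(u, w) \<in> parcs G")
    case True
    then have "awalk u ((u, w) # p) v" using p by (simp add: awalk_Cons_iff)
    then show ?thesis using p(2) by (intro exI[of _ "(u, w) # p"]) simp
  next
    case False
    then have "w = u" using w(1) by (auto simp: closed_adj_def)
    then show ?thesis using p by (intro exI[of _ p]) simp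
  qed
qed

text \<open>Cutting out cycles only shortens a walk. This links \<open>gdist\<close>, a minimum over
  paths, to the walks that relation powers produce.\<close>

lemma (in wf_digraph) length_awalk_to_apath_le:
  assumes "awalk u p v"
  shows "length (awalk_to_apath p) \<le> length p"
  using assms
proof (induct rule: awalk_to_apath_induct)
  case (path p)
  then show ?case by (auto simp: awalk_to_apath.simps)
next
  case (decomp p q r s)
  then have "p = q @ r @ s" using awalk_cyc_decomp_has_prop[of u p v] by auto
  then show ?case using decomp step_awalk_to_apath[of u p v q r s] by simp
qed

lemma (in pair_wf_digraph) gdist_apath:
  assumes "awalk u p v"
  shows "\<exists>q. apath u q v \<and> length q = gdist G u v"
proof -
  have "\<exists>n q. apath u q v \<and> length q = n" using apath_awalk_to_apath[OF assms] by blast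
  then show ?thesis unfolding gdist_def by (rule LeastI_ex)
qed

lemma (in pair_wf_digraph) gdist_le_awalk:
  assumes "awalk u p v"
  shows "gdist G u v \<le> length p"
proof -
  have "gdist G u v \<le> length (awalk_to_apath p)"
    unfolding gdist_def using apath_awalk_to_apath[OF assms] by (blast intro: Least_le)
  then show ?thesis using length_awalk_to_apath_le[OF assms] by simp
qed

text \<open>Membership in some power \<open>m\<close> records that \<open>v\<close> is reachable
  from \<open>u\<close>; otherwise the \<open>LEAST\<close> in \<open>gdist\<close> would range over
  an empty set.\<close>

lemma gdist_le_iff_closed_adj_power:
  assumes "pair_wf_digraph G" and "u \<in> pverts G" and "(u, v) \<in> closed_adj G ^^ m"
  shows "gdist G u v \<le> n \<longleftrightarrow> (u, v) \<in> closed_adj G ^^ n"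
proof -
  interpret pair_wf_digraph G by fact
  obtain p where "awalk u p v" using closed_adj_power_imp_awalk assms(2,3) by blast
  then obtain q where "awalk u q v" "length q = gdist G u v"
    using gdist_apath awalkI_apath by blast
  then show ?thesis
    using awalk_imp_closed_adj_power closed_adj_power_imp_awalk[OF assms(2)] gdist_le_awalk
    by (metis order_trans)
qed

lemma connected_imp_closed_adj_power:
  assumes "pair_graph G" and "Digraph_Component.connected (with_proj G)"
    and "u \<in> pverts G" and "v \<in> pverts G"
  shows "\<exists>m. (u, v) \<in> closed_adj G ^^ m"
proof -
  interpret pair_graph G by fact
  have "strongly_connected (with_proj G)"
    using symmetric_connected_imp_strongly_connected assms(2) pair_sym_arcs by blast
  then obtain p where "awalk u p v" using assms(3,4) reachable_awalk
    unfolding strongly_connected_def with_proj_simps by blast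
  then show ?thesis using awalk_imp_closed_adj_power by blast
qed

lemma gdist_le_iff:
  assumes "pair_graph G" and "Digraph_Component.connected (with_proj G)"
    and "u \<in> pverts G" and "v \<in> pverts G"
  shows "gdist G u v \<le> n \<longleftrightarrow> (u, v) \<in> closed_adj G ^^ n"
  using connected_imp_closed_adj_power[OF assms] assms(3)
    gdist_le_iff_closed_adj_power pair_graph.axioms(1)[OF assms(1)]
  by (metis pair_digraph_def pair_fin_digraph_def)

lemma gdist_eq_0_iff:
  assumes "pair_graph G" and "Digraph_Component.connected (with_proj G)"
    and "u \<in> pverts G" and "v \<in> pverts G"
  shows "gdist G u v = 0 \<longleftrightarrow> u = v"
  using gdist_le_iff[OF assms, of 0] by simp

lemma sym_closed_adj:
  assumes "pair_graph G"
  shows "sym (closed_adj G)"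
proof -
  interpret pair_graph G by fact
  have "sym (parcs G)" using pair_sym_arcs by (simp add: symmetric_def)
  then show ?thesis by (auto simp: closed_adj_def sym_def)
qed

lemma sym_relpow:
  assumes "sym R"
  shows "sym (R ^^ n)"
proof (induction n)
  case (Suc n)
  have "(R ^^ Suc n)\<inverse> = R ^^ Suc n"
    using Suc assms by (simp add: converse_relcomp sym_conv_converse_eq relpow_commute)
  then show ?case by (simp only: sym_conv_converse_eq)
qed (simp add: sym_Id)

lemma gdist_commute:
  assumes "pair_graph G" and "Digraph_Component.connected (with_proj G)"
    and "u \<in> pverts G" and "v \<in> pverts G"
  shows "gdist G u v = gdist G v u"
proof -
  \<comment> \<open>Equality of distances is shown through their upper bounds \<open>n\<close>,
    since only these translate into powers; the same device recurs below.\<close>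
  have "gdist G u v \<le> n \<longleftrightarrow> gdist G v u \<le> n" for n
    using assms gdist_le_iff sym_relpow[OF sym_closed_adj] by (metis symD)
  then show ?thesis by (meson order_antisym order_refl)
qed

text \<open>The part of the geodesic after \<open>x\<close> is a walk to \<open>w\<close>, and the
  part before it is nonempty because \<open>x \<noteq> y\<close>.\<close>

lemma geodesic_interval_imp_gdist_less:
  assumes "pair_graph G" and "x \<in> geodesic_interval G y w" and "x \<noteq> y"
  shows "gdist G x w < gdist G y w"
proof -
  interpret pair_graph G by fact
  obtain p where p: "apath y p w" "length p = gdist G y w" "x \<in> set (pawalk_verts y p)"
    using assms(2) by (auto simp: geodesic_interval_def)
  then obtain q r where qr: "p = q @ r" "awalk y q x" "awalk x r w"
    using awalk_decomp awalkI_apath by blast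
  then have "q \<noteq> []" using assms(3) by (auto simp: awalk_Nil_iff)
  then show ?thesis using gdist_le_awalk[OF qr(3)] qr(1) p(2) by (cases q) auto
qed

section \<open>Distances in the strong product\<close>

lemma pair_wf_digraph_strong_product:
  assumes "pair_graph G" and "pair_graph H"
  shows "pair_wf_digraph (strong_product G H)"
proof -
  interpret G: pair_graph G by fact
  interpret H: pair_graph H by fact
  show ?thesis
    by unfold_locales
      (auto simp: strong_product_def dest: G.wellformed' H.wellformed')
qed

text \<open>The three kinds of product arcs and the loops are the four combinations of "equal" and
  "adjacent" in the two coordinates.\<close>

lemma closed_adj_strong_product:
  "((a, b), (c, d)) \<in> closed_adj (strong_product G H) \<longleftrightarrow>
     (a, c) \<in> closed_adj G \<and> (b, d) \<in> closed_adj H"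
  by (auto simp: closed_adj_def strong_product_def)

lemma closed_adj_power_strong_product:
  "((a, b), (c, d)) \<in> closed_adj (strong_product G H) ^^ n \<longleftrightarrow>
     (a, c) \<in> closed_adj G ^^ n \<and> (b, d) \<in> closed_adj H ^^ n"
proof (induction n arbitrary: c d)
  case (Suc n)
  then show ?case
    by (fastforce simp: closed_adj_strong_product relcomp_unfold)
qed simp

lemma strong_product_gdist_le_iff:
  assumes G: "pair_graph G" "Digraph_Component.connected (with_proj G)"
    and H: "pair_graph H" "Digraph_Component.connected (with_proj H)"
    and "x \<in> pverts G \<times> pverts H" and "y \<in> pverts G \<times> pverts H"
  shows "gdist (strong_product G H) x y \<le> n \<longleftrightarrow> (x, y) \<in> closed_adj (strong_product G H) ^^ n"
proof -
  obtain a b c d where xy: "x = (a, b)" "y = (c, d)"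
    and v: "a \<in> pverts G" "b \<in> pverts H" "c \<in> pverts G" "d \<in> pverts H"
    using assms(5,6) by auto
  \<comment> \<open>A common exponent for both factors: loops let the closer coordinate wait for the
    other. It witnesses reachability in the product.\<close>
  let ?m = "max (gdist G a c) (gdist H b d)"
  have "(x, y) \<in> closed_adj (strong_product G H) ^^ ?m"
    unfolding xy closed_adj_power_strong_product
    using gdist_le_iff[OF G v(1,3), of ?m] gdist_le_iff[OF H v(2,4), of ?m] by simp
  moreover have "x \<in> pverts (strong_product G H)" using assms(5) by (simp add: strong_product_def)
  ultimately show ?thesis
    using pair_wf_digraph_strong_product[OF G(1) H(1)] by (intro gdist_le_iff_closed_adj_power)
qed

lemma gdist_strong_product:
  assumes G: "pair_graph G" "Digraph_Component.connected (with_proj G)"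
    and H: "pair_graph H" "Digraph_Component.connected (with_proj H)"
    and v: "a \<in> pverts G" "b \<in> pverts H" "c \<in> pverts G" "d \<in> pverts H"
  shows "gdist (strong_product G H) (a, b) (c, d) = max (gdist G a c) (gdist H b d)"
proof -
  have "gdist (strong_product G H) (a, b) (c, d) \<le> n \<longleftrightarrow> max (gdist G a c) (gdist H b d) \<le> n" for n
    using v by (simp add: strong_product_gdist_le_iff[OF G H] closed_adj_power_strong_product
        gdist_le_iff[OF G] gdist_le_iff[OF H])
  then show ?thesis by (meson order_antisym order_refl)
qed

section \<open>Upper bound: a metric generator of the product\<close>

lemma gdist_le_diameter:
  assumes "finite (pverts G)" and "u \<in> pverts G" and "v \<in> pverts G"
  shows "gdist G u v \<le> diameter G"
proof -
  have "{gdist G u v |u v. u \<in> pverts G \<and> v \<in> pverts G} =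
      (\<lambda>(u, v). gdist G u v) ` (pverts G \<times> pverts G)"
    by auto
  then have "finite {gdist G u v |u v. u \<in> pverts G \<and> v \<in> pverts G}"
    using assms(1) by simp
  then show ?thesis unfolding diameter_def using assms(2,3) by (blast intro: Max_ge)
qed

lemma metric_generator_strong_product:
  assumes G: "pair_graph G" "Digraph_Component.connected (with_proj G)"
    and H: "pair_graph H" "self_resolved k H"
    and "diameter G < k" and S: "metric_generator G S" "S \<noteq> {}"
  shows "metric_generator (strong_product G H) (S \<times> pverts H)"
proof -
  interpret G: pair_graph G by fact
  have Hc: "Digraph_Component.connected (with_proj H)" using H(2) by (simp add: self_resolved_def)
  note dist = gdist_strong_product[OF G H(1) Hc]
  have SG: "S \<subseteq> pverts G" using S(1) by (simp add: metric_generator_def)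
  obtain s where s: "s \<in> S" "s \<in> pverts G" using S(2) SG by blast
  \<comment> \<open>One of the two alternatives of \<open>self_resolved\<close>; the other follows
    by exchanging \<open>(a, b)\<close> and \<open>(c, d)\<close>. The first coordinate of the
    landmark can be the same \<open>s\<close> throughout.\<close>
  have layers: "\<exists>w\<in>pverts H. gdist (strong_product G H) (s, w) (a, b)
      < gdist (strong_product G H) (s, w) (c, d)"
    if v: "a \<in> pverts G" "b \<in> pverts H" "c \<in> pverts G" "d \<in> pverts H" and "b \<noteq> d"
      and w: "w \<in> pverts H" "gdist H d w \<ge> k" "b \<in> geodesic_interval H d w" for a b c d w
  proof -
    have "gdist H w b < gdist H w d"
      using geodesic_interval_imp_gdist_less[OF H(1) w(3) \<open>b \<noteq> d\<close>] gdist_commute[OF H(1) Hc] v w(1)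
      by simp
    \<comment> \<open>Here \<open>diameter G < k\<close> enters: both entries of the maximum for
      \<open>(a, b)\<close> fall below \<open>gdist H w d\<close>, hence below the maximum for
      \<open>(c, d)\<close>.\<close>
    moreover have "gdist G s x < gdist H w d" if "x \<in> pverts G" for x
      using gdist_le_diameter[OF G.pair_finite_verts s(2) that] \<open>diameter G < k\<close> w(2)
        gdist_commute[OF H(1) Hc w(1) v(4)] by simp
    ultimately show ?thesis using w(1) s v by (intro bexI[of _ w]) (auto simp: dist less_max_iff_disj)
  qed
  have "\<exists>t\<in>S \<times> pverts H. gdist (strong_product G H) t (a, b) \<noteq> gdist (strong_product G H) t (c, d)"
    if v: "a \<in> pverts G" "b \<in> pverts H" "c \<in> pverts G" "d \<in> pverts H" and ne: "(a, b) \<noteq> (c, d)"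
    for a b c d
  proof (cases "b = d")
    case True
    then obtain t where "t \<in> S" "gdist G t a \<noteq> gdist G t c"
      using S(1) v ne unfolding metric_generator_def by blast
    \<comment> \<open>Seen from \<open>(t, b)\<close>, the maximum reduces to the distance in
      \<open>G\<close>.\<close>
    moreover have "gdist H b b = 0" using v gdist_eq_0_iff[OF H(1) Hc] by blast
    ultimately show ?thesis using True v SG by (intro bexI[of _ "(t, b)"]) (auto simp: dist)
  next
    case False
    then obtain w where "w \<in> pverts H"
      "gdist H d w \<ge> k \<and> b \<in> geodesic_interval H d w \<or> gdist H b w \<ge> k \<and> d \<in> geodesic_interval H b w"
      using H(2) v unfolding self_resolved_def by blast
    then have "\<exists>w\<in>pverts H. gdist (strong_product G H) (s, w) (a, b)
        \<noteq> gdist (strong_product G H) (s, w) (c, d)"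
      using layers[OF v False] layers[OF v(3,4,1,2) False[symmetric]] by (metis less_irrefl)
    then show ?thesis using s by blast
  qed
  then show ?thesis using SG by (auto simp: metric_generator_def strong_product_def)
qed

section \<open>Lower bound: true twins\<close>

lemma equiv_true_twin_rel: "equiv (pverts G) (true_twin_rel G)"
  by (auto simp: true_twin_rel_def intro!: equivI refl_onI symI transI)

text \<open>The last step of a chain into \<open>x\<close> can be redirected to \<open>y\<close> and
  conversely. The inequalities settle power zero, where there is no last step.\<close>

lemma twin_relpow_iff:
  assumes "\<And>z. (z, x) \<in> R \<longleftrightarrow> (z, y) \<in> R" and "s \<noteq> x" and "s \<noteq> y"
  shows "(s, x) \<in> R ^^ n \<longleftrightarrow> (s, y) \<in> R ^^ n"
  using assms by (cases n) auto

text \<open>\<open>closed_nbhd\<close> collects out-neighbours; symmetry turns equality of these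
  sets into agreement of incoming steps, the form used by \<open>twin_relpow_iff\<close>.\<close>

lemma true_twin_closed_adj_iff:
  assumes "pair_graph G" and "(a, a') \<in> true_twin_rel G"
  shows "(z, a) \<in> closed_adj G \<longleftrightarrow> (z, a') \<in> closed_adj G"
proof -
  have "(v, u) \<in> closed_adj G \<longleftrightarrow> u \<in> closed_nbhd G v" if "v \<in> pverts G" for u v
    using that by (auto simp: closed_adj_def closed_nbhd_def)
  then have "(a, z) \<in> closed_adj G \<longleftrightarrow> (a', z) \<in> closed_adj G"
    using assms(2) by (auto simp: true_twin_rel_def)
  then show ?thesis using sym_closed_adj[OF assms(1)] by (meson symD)
qed

lemma metric_generator_strong_product_twins:
  assumes G: "pair_graph G" "Digraph_Component.connected (with_proj G)"
    and H: "pair_graph H" "Digraph_Component.connected (with_proj H)"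
    and S: "metric_generator (strong_product G H) S"
    and twins: "(a, a') \<in> true_twin_rel G" "a \<noteq> a'" and b: "b \<in> pverts H"
  shows "(a, b) \<in> S \<or> (a', b) \<in> S"
proof (rule ccontr)
  assume neg: "\<not> ((a, b) \<in> S \<or> (a', b) \<in> S)"
  have v: "(a, b) \<in> pverts G \<times> pverts H" "(a', b) \<in> pverts G \<times> pverts H"
    using twins b by (auto simp: true_twin_rel_def)
  then obtain s where s: "s \<in> S"
    "gdist (strong_product G H) s (a, b) \<noteq> gdist (strong_product G H) s (a', b)"
    using S \<open>a \<noteq> a'\<close> unfolding metric_generator_def strong_product_def by fastforce
  have "s \<in> pverts G \<times> pverts H"
    using s(1) S by (auto simp: metric_generator_def strong_product_def)
  \<comment> \<open>The twin property lifts to the product because closed adjacency is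
    coordinatewise and \<open>b\<close> is shared.\<close>
  moreover have "(z, (a, b)) \<in> closed_adj (strong_product G H)
      \<longleftrightarrow> (z, (a', b)) \<in> closed_adj (strong_product G H)" for z
    using true_twin_closed_adj_iff[OF G(1) twins(1)] by (cases z) (simp add: closed_adj_strong_product)
  moreover have "s \<noteq> (a, b)" "s \<noteq> (a', b)" using s(1) neg by auto
  ultimately have "gdist (strong_product G H) s (a, b) \<le> n
      \<longleftrightarrow> gdist (strong_product G H) s (a', b) \<le> n" for n
    using v strong_product_gdist_le_iff[OF G H, of s]
      twin_relpow_iff[of "(a, b)" "closed_adj (strong_product G H)" "(a', b)" s n]
    by metis
  then show False using s(2) by (meson order_antisym order_refl)
qed

lemma card_metric_generator_strong_product_ge:
  assumes G: "pair_graph G" "Digraph_Component.connected (with_proj G)"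
    and H: "pair_graph H" "Digraph_Component.connected (with_proj H)"
    and S: "metric_generator (strong_product G H) S"
  shows "card (pverts H) * (card (pverts G) - card (true_twin_classes G)) \<le> card S"
proof -
  interpret G: pair_graph G by fact
  interpret H: pair_graph H by fact
  let ?V = "pverts G \<times> pverts H"
  let ?f = "\<lambda>(a, b). (true_twin_rel G `` {a}, b)"
  have fin: "finite ?V" using G.pair_finite_verts H.pair_finite_verts by simp
  have "S \<subseteq> ?V" using S by (simp add: metric_generator_def strong_product_def)
  \<comment> \<open>A collision of \<open>?f\<close> outside \<open>S\<close> would be a pair of
    product twins both missed by \<open>S\<close>.\<close>
  have "inj_on ?f (?V - S)"
  proof (rule inj_onI)
    fix x y assume xy: "x \<in> ?V - S" "y \<in> ?V - S" "?f x = ?f y"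
    obtain a b a' where x: "x = (a, b)" and y: "y = (a', b)"
      and "true_twin_rel G `` {a} = true_twin_rel G `` {a'}"
      using xy(3) by (cases x; cases y) auto
    moreover have "a \<in> pverts G" "a' \<in> pverts G" "b \<in> pverts H" using xy(1,2) x y by auto
    ultimately have "(a, a') \<in> true_twin_rel G"
      using eq_equiv_class_iff[OF equiv_true_twin_rel] by metis
    then show "x = y"
      using metric_generator_strong_product_twins[OF G H S, of a a' b] xy(1,2) x y \<open>b \<in> pverts H\<close>
      by auto
  qed
  moreover have "?f ` (?V - S) \<subseteq> true_twin_classes G \<times> pverts H"
    by (auto simp: true_twin_classes_def quotientI)
  moreover have "finite (true_twin_classes G)"
    unfolding true_twin_classes_def using G.pair_finite_verts
    by (simp add: quotient_def)
  ultimately have "card (?V - S) \<le> card (true_twin_classes G) * card (pverts H)"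
    using H.pair_finite_verts by (metis card_cartesian_product card_inj_on_le finite_cartesian_product)
  moreover have "card (?V - S) = card (pverts G) * card (pverts H) - card S"
    using fin \<open>S \<subseteq> ?V\<close> by (simp add: card_Diff_subset finite_subset card_cartesian_product)
  \<comment> \<open>With truncated subtraction, \<open>x - y \<le> z\<close> and
    \<open>x - z \<le> y\<close> are still equivalent, so the bound on the complement becomes one on
    \<open>card S\<close>.\<close>
  ultimately show ?thesis by (simp add: diff_mult_distrib2 mult.commute)
qed

section \<open>Attained dimension and the final equality\<close>

lemma metric_basis_exists:
  assumes "pair_graph G" and "Digraph_Component.connected (with_proj G)"
  shows "\<exists>S. finite S \<and> metric_generator G S \<and> card S = metric_dim G"
proof -
  interpret pair_graph G by fact
  \<comment> \<open>Each vertex resolves itself from any other, being at distance zero from itself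
    only. So the \<open>LEAST\<close> in \<open>metric_dim\<close> is attained.\<close>
  have "metric_generator G (pverts G)"
    using gdist_eq_0_iff[OF assms] unfolding metric_generator_def by (metis order_refl)
  then have "\<exists>n S. finite S \<and> metric_generator G S \<and> card S = n" using pair_finite_verts by blast
  then show ?thesis unfolding metric_dim_def by (rule LeastI_ex)
qed

theorem theorem4:
  fixes G :: "'a pair_pre_digraph" and H :: "'b pair_pre_digraph"
    and k n\<^sub>1 n\<^sub>2 t\<^sub>1 :: nat
  assumes "pair_graph H" and "self_resolved k H" and "card (pverts H) = n\<^sub>2"
    and "pair_graph G" and "Digraph_Component.connected (with_proj G)"
    and "card (pverts G) = n\<^sub>1" and "n\<^sub>1 \<ge> 2"
    and "card (true_twin_classes G) = t\<^sub>1"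
    and "diameter G < k"
    and "metric_dim G = n\<^sub>1 - t\<^sub>1"
  shows "metric_dim (strong_product G H) = n\<^sub>2 * (n\<^sub>1 - t\<^sub>1)"
proof -
  interpret H: pair_graph H by fact
  have Hc: "Digraph_Component.connected (with_proj H)"
    using assms(2) by (simp add: self_resolved_def)
  obtain S where S: "finite S" "metric_generator G S" "card S = n\<^sub>1 - t\<^sub>1"
    using metric_basis_exists[OF assms(4,5)] assms(10) by auto
  \<comment> \<open>Two distinct vertices must be resolved by some element of \<open>S\<close>. This
    makes \<open>S\<close> nonempty, so a first coordinate \<open>s\<close> for the landmarks
    exists.\<close>
  have "\<not> card (pverts G) \<le> 1" using assms(6,7) by simp
  then obtain x y where "x \<in> pverts G" "y \<in> pverts G" "x \<noteq> y"
    by (metis card_gt_0_iff card_le_Suc0_iff_eq One_nat_def not_gr_zero le0)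
  then have "S \<noteq> {}" using S(2) by (auto simp: metric_generator_def)
  then have "metric_generator (strong_product G H) (S \<times> pverts H)"
    using metric_generator_strong_product assms(1,2,4,5,9) S(2) by blast
  moreover have "finite (S \<times> pverts H)" "card (S \<times> pverts H) = n\<^sub>2 * (n\<^sub>1 - t\<^sub>1)"
    using S H.pair_finite_verts assms(3) by (simp_all add: card_cartesian_product)
  ultimately show ?thesis
    unfolding metric_dim_def
    using card_metric_generator_strong_product_ge[OF assms(4,5,1) Hc] assms(3,6,8)
    by (intro Least_equality) blast+
qed

end
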